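(* Let $p$ be a positive integer. Then $$\mathrm{ex}(p+5,B_p)=\begin{cases}\frac{(p+2)(p+5)}{2} & \text{if } p\equiv 1 \pmod 3,\\ \frac{(p+1)(p+6)}{2} & \text{if } p\equiv 0 \text{ or } 2 \pmod 3.\end{cases}$$
   Context: The book $B_p$ is the graph consisting of $p$ triangles sharing a common edge. For a graph $H$ and positive integer $n$, $\mathrm{ex}(n,H)$ is the maximum number of edges of a simple graph of order $n$ not containing $H$ as a subgraph. *)

theory Defs
  imports Complex_Main
begin

type_synonym 'a graph = "'a set \<times> 'a set set"

abbreviation verts :: "'a graph \<Rightarrow> 'a set" where
  "verts G \<equiv> fst G"

abbreviation edges :: "'a graph \<Rightarrow> 'a set set" where
  "edges G \<equiv> snd G"

definition simple_graph :: "'a graph \<Rightarrow> bool" where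
  "simple_graph G \<longleftrightarrow>
     finite (verts G) \<and> (\<forall>e \<in> edges G. e \<subseteq> verts G \<and> card e = 2)"

text \<open>Subgraphs are not required to be induced, and are taken up to isomorphism.\<close>

definition contains_subgraph :: "'a graph \<Rightarrow> 'b graph \<Rightarrow> bool" where
  "contains_subgraph G H \<longleftrightarrow>
     (\<exists>f. inj_on f (verts H) \<and> f ` verts H \<subseteq> verts G \<and> (\<forall>e \<in> edges H. f ` e \<in> edges G))"

text \<open>
  Every finite graph is isomorphic to one whose vertices are natural numbers, so it suffices to let
  \<open>G\<close> range over the latter. The maximum is meaningful whenever \<open>H\<close> has an edge and
  its vertex set is finite: the numbers in question are at most \<open>n choose 2\<close>, and
  the edgeless graph of order \<open>n\<close> contributes \<open>0\<close>.
\<close>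

definition ex_number :: "nat \<Rightarrow> 'b graph \<Rightarrow> nat" where
  "ex_number n H =
     Max {card (edges G) | G :: nat graph.
            simple_graph G \<and> card (verts G) = n \<and> \<not> contains_subgraph G H}"

text \<open>The common edge is \<open>{0, 1}\<close>; the apexes of the \<open>p\<close> triangles are \<open>2, \<dots>, p + 1\<close>.\<close>

definition book :: "nat \<Rightarrow> nat graph" where
  "book p = ({..<p + 2}, {{0, 1}} \<union> (\<Union>i \<in> {2..<p + 2}. {{0, i}, {1, i}}))"

end

theory Submission
  imports Defs
begin

text \<open>
  On \<open>p + 5\<close> vertices, a graph is \<open>B\<^sub>p\<close>-free iff in its complement any two distinct nonadjacent
  vertices have at least four neighbours in total. Under this condition the degree sum is large at
  once if some vertex has degree at most 1. If all degrees are at least 2, then two vertices of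
  degree 2 with a common neighbour must be adjacent; when the degree sum is less than \<open>2n + 4\<close>, this
  forces the complement to be a union of triangles, up to edges joining vertices of degree greater
  than 2, so that \<open>3\<close> divides \<open>n\<close>. Disjoint triangles, together with a \<open>K\<^sub>4\<close> or a certain graph on
  8 vertices when \<open>n\<close> is not divisible by 3, show that the bounds are attained.
\<close>

section \<open>Degree sums in complements of book-free graphs\<close>

text \<open>\<open>R\<close> stands for adjacency in the complement of a \<open>B_p\<close>-free
  graph on \<open>p + 5\<close> vertices. In this form the condition \<open>four\<close> no longer
  involves \<open>p\<close>.\<close>

locale cobook =
  fixes V :: "'a set" and R :: "'a \<Rightarrow> 'a \<Rightarrow> bool"
  assumes finite_V: "finite V"
    and sym: "R u v \<Longrightarrow> R v u"
    and irrefl: "\<not> R v v"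
    and in_V: "R u v \<Longrightarrow> u \<in> V"
    and four: "\<lbrakk>u \<in> V; v \<in> V; u \<noteq> v; \<not> R u v\<rbrakk> \<Longrightarrow> 4 \<le> card (Collect (R u) \<union> Collect (R v))"
begin

abbreviation deg :: "'a \<Rightarrow> nat" where
  "deg v \<equiv> card (Collect (R v))"

lemma nbrs_subset: "Collect (R v) \<subseteq> V"
  using in_V sym by blast

lemma finite_nbrs [simp]: "finite (Collect (R v))"
  using finite_subset[OF nbrs_subset finite_V] .

lemma card_pairs: "card {(x, y). R x y} = (\<Sum>v\<in>V. deg v)"
proof -
  have "{(x, y). R x y} = (SIGMA v:V. Collect (R v))"
    using in_V by auto
  then show ?thesis
    using finite_V by simp
qed

text \<open>If \<open>a\<close> and \<open>c\<close> were nonadjacent, their common neighbour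
  \<open>b\<close> would leave at most 2 + 2 - 1 = 3 vertices in the union of the neighbourhoods,
  against \<open>four\<close>.\<close>

lemma deg_2_adjacent:
  assumes "R a b" "R b c" "a \<noteq> c" "deg a = 2" "deg c = 2"
  shows "R a c"
proof (rule ccontr)
  assume "\<not> R a c"
  then have "4 \<le> card (Collect (R a) \<union> Collect (R c))"
    using assms in_V sym by (intro four) blast+
  moreover have "0 < card (Collect (R a) \<inter> Collect (R c))"
    using assms sym by (subst card_gt_0_iff) auto
  moreover have "card (Collect (R a)) + card (Collect (R c)) =
      card (Collect (R a) \<union> Collect (R c)) + card (Collect (R a) \<inter> Collect (R c))"
    by (rule card_Un_Int) auto
  ultimately show False
    using assms by linarith
qed

text \<open>The vertices fall into triangles: relating adjacent vertices of which at least one has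
  degree 2 yields an equivalence whose classes all have three elements. By \<open>T\<close>, a
  vertex of larger degree has two neighbours of degree 2, and these complete its class.\<close>

lemma dvd_card_V:
  assumes deg: "\<And>v. v \<in> V \<Longrightarrow> 2 \<le> deg v"
    and T: "\<And>x. x \<in> V \<Longrightarrow> deg x \<noteq> 2 \<Longrightarrow> 2 \<le> card {y. R x y \<and> deg y = 2}"
  shows "3 dvd card V"
proof -
  \<comment> \<open>Edges with neither end of degree 2 are left out, since they may join different
    triangles.\<close>
  define r where "r = {(x, y). x \<in> V \<and> y \<in> V \<and> (x = y \<or> R x y \<and> (deg x = 2 \<or> deg y = 2))}"
  have other: "\<exists>y'. R x y' \<and> deg y' = 2 \<and> y' \<noteq> y" if "x \<in> V" "deg x \<noteq> 2" for x y
  proof (rule ccontr)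
    assume "\<not> ?thesis"
    then have "{y. R x y \<and> deg y = 2} \<subseteq> {y}" by auto
    then have "card {y. R x y \<and> deg y = 2} \<le> 1"
      using card_mono[of "{y}"] by fastforce
    then show False using T[OF that] by simp
  qed
  have two: "w = x \<or> w = z" if "deg y = 2" "R y x" "R y z" "x \<noteq> z" "R y w" for w x y z
  proof -
    have "{x, z} = Collect (R y)"
      by (rule card_subset_eq) (use that in auto)
    then show ?thesis using that by blast
  qed
  \<comment> \<open>If \<open>deg x\<close> is not 2, \<open>T\<close> supplies a second degree-2
    neighbour \<open>y'\<close> of \<open>x\<close>. Then \<open>y\<close> and \<open>y'\<close> are
    adjacent; as \<open>y\<close> has only the neighbours \<open>x\<close> and \<open>z\<close>, it
    follows that \<open>y'\<close> is \<open>z\<close>.\<close>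
  have adj: "R x z" if "R x y" "R y z" "x \<noteq> z" "deg z = 2" "deg y = 2" for x y z
  proof (cases "deg x = 2")
    case True
    then show ?thesis using deg_2_adjacent that by blast
  next
    case False
    then obtain y' where y': "R x y'" "deg y' = 2" "y' \<noteq> y"
      using other[OF in_V[OF \<open>R x y\<close>]] by blast
    then have "R y y'"
      using deg_2_adjacent[of y x y'] that sym by blast
    then have "y' = x \<or> y' = z"
      using two[of y x z y'] that sym by blast
    then show ?thesis using y' irrefl by blast
  qed
  \<comment> \<open>The same \<open>y'\<close> would have to be \<open>x\<close> or
    \<open>z\<close>, but now neither of these has degree 2.\<close>
  have not_both: "deg x = 2 \<or> deg z = 2" if "R x y" "R y z" "x \<noteq> z" "deg y = 2" for x y z
  proof (rule ccontr)
    assume *: "\<not> ?thesis"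
    then obtain y' where y': "R x y'" "deg y' = 2" "y' \<noteq> y"
      using other[OF in_V[OF \<open>R x y\<close>]] by blast
    then have "R y y'"
      using deg_2_adjacent[of y x y'] that sym by blast
    then have "y' = x \<or> y' = z"
      using two[of y x z y'] that sym by blast
    then show False using y' * by blast
  qed
  have equiv: "equiv V r"
  proof (rule equivI)
    show "r \<subseteq> V \<times> V" "refl_on V r" "sym r"
      using sym by (auto simp: r_def refl_on_def sym_def)
    show "trans r"
    proof (rule transI)
      fix x y z assume xy: "(x, y) \<in> r" and yz: "(y, z) \<in> r"
      show "(x, z) \<in> r"
      proof (cases "x = y \<or> y = z \<or> x = z")
        case True
        then show ?thesis using xy yz by (auto simp: r_def)
      next
        case False
        then have R: "R x y" "R y z" "x \<noteq> z" "deg x = 2 \<or> deg y = 2" "deg y = 2 \<or> deg z = 2"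
          using xy yz by (auto simp: r_def)
        \<comment> \<open>If \<open>deg y\<close> is 2, \<open>not_both\<close> gives an end of
          degree 2, and \<open>adj\<close> read in the matching direction closes the triangle.
          Otherwise both ends have degree 2.\<close>
        have "R x z \<and> (deg x = 2 \<or> deg z = 2)"
        proof (cases "deg y = 2")
          case True
          then show ?thesis
            using not_both[OF R(1-3)] adj[OF R(1-3)] adj[of z y x] R sym by blast
        next
          case False
          then show ?thesis using deg_2_adjacent R by blast
        qed
        then show ?thesis using xy yz by (auto simp: r_def)
      qed
    qed
  qed
  \<comment> \<open>A vertex of degree 2 is related to itself and to both neighbours, whatever their
    degrees.\<close>
  have class_2: "card (r `` {x}) = 3" if "x \<in> V" "deg x = 2" for x
  proof -
    have "r `` {x} = insert x (Collect (R x))"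
      using that nbrs_subset by (auto simp: r_def)
    then show ?thesis using that irrefl by simp
  qed
  have "3 dvd card X" if X: "X \<in> V // r" for X
  proof -
    obtain x where x: "x \<in> V" "X = r `` {x}"
      using X by (rule quotientE)
    have "card X = 3"
    proof (cases "deg x = 2")
      case True
      then show ?thesis using x class_2 by simp
    next
      case False
      then obtain y where y: "R x y" "deg y = 2"
        using other x by blast
      then have "(x, y) \<in> r"
        using x nbrs_subset by (auto simp: r_def)
      then have "X = r `` {y}" "y \<in> V"
        using x equiv_class_eq[OF equiv] by (auto simp: r_def)
      then show ?thesis using class_2 y by simp
    qed
    then show ?thesis by simp
  qed
  then show ?thesis
    by (rule equiv_imp_dvd_card[OF finite_V equiv])
qed

text \<open>The excesses of the degrees over 2 add up to at most 2. If \<open>x\<close> has excess d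
  > 0, at most 2 - d other vertices have degree above 2, so at least (2 + d) - (2 - d) = 2d
  neighbours of \<open>x\<close> have degree 2, as \<open>dvd_card_V\<close> demands.\<close>

lemma small_excess_dvd_card_V:
  assumes deg: "\<And>v. v \<in> V \<Longrightarrow> 2 \<le> deg v"
    and excess: "(\<Sum>v\<in>V. deg v) \<le> 2 * card V + 2"
  shows "3 dvd card V"
proof (rule dvd_card_V[OF deg])
  fix x assume x: "x \<in> V" "deg x \<noteq> 2"
  define T where "T = {v \<in> V. deg v \<noteq> 2} - {x}"
  have "finite T" using finite_V by (simp add: T_def)
  \<comment> \<open>Subtraction on the naturals loses nothing here, because all degrees are at least
    2.\<close>
  have "(\<Sum>v\<in>V. deg v) = (\<Sum>v\<in>V. (deg v - 2) + 2)"
    by (intro sum.cong refl le_add_diff_inverse2[symmetric] deg)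
  then have "(\<Sum>v\<in>V. deg v - 2) \<le> 2"
    using excess by (simp only: sum.distrib) simp
  moreover have "(\<Sum>v\<in>insert x T. deg v - 2) \<le> (\<Sum>v\<in>V. deg v - 2)"
    using x finite_V by (intro sum_mono2) (auto simp: T_def)
  moreover have "(\<Sum>v\<in>insert x T. deg v - 2) = (deg x - 2) + (\<Sum>v\<in>T. deg v - 2)"
    using \<open>finite T\<close> by (subst sum.insert) (auto simp: T_def)
  moreover have "card T \<le> (\<Sum>v\<in>T. deg v - 2)"
    using sum_mono[of T "\<lambda>_. 1" "\<lambda>v. deg v - 2"] deg by (fastforce simp: T_def)
  ultimately have le: "(deg x - 2) + card T \<le> 2" by linarith
  have "Collect (R x) - T \<subseteq> {y. R x y \<and> deg y = 2}"
    using irrefl nbrs_subset by (auto simp: T_def)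
  then have "card (Collect (R x) - T) \<le> card {y. R x y \<and> deg y = 2}"
    by (intro card_mono finite_subset[OF _ finite_nbrs[of x]]) auto
  moreover have "deg x - card T \<le> card (Collect (R x) - T)"
    by (rule diff_card_le_card_Diff) (rule \<open>finite T\<close>)
  ultimately show "2 \<le> card {y. R x y \<and> deg y = 2}"
    using le deg[OF x(1)] x(2) by linarith
qed

text \<open>With all degrees at least 2, a sum above 2n + 2 is at least 2n + 4 by parity, where n is
  \<open>card V\<close>. A vertex of degree at most 1 contributes so little to \<open>four\<close>
  that its nonneighbours must have large degree.\<close>

lemma degree_sum_ge:
  assumes "6 \<le> card V" and even: "even (\<Sum>v\<in>V. deg v)"
  shows "2 * card V \<le> (\<Sum>v\<in>V. deg v)"
    and "\<not> 3 dvd card V \<Longrightarrow> 2 * card V + 4 \<le> (\<Sum>v\<in>V. deg v)"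
proof -
  have "2 * card V \<le> (\<Sum>v\<in>V. deg v) \<and> (\<not> 3 dvd card V \<longrightarrow> 2 * card V + 4 \<le> (\<Sum>v\<in>V. deg v))"
  proof (cases "\<forall>v\<in>V. 2 \<le> deg v")
    case True
    then have "2 * card V \<le> (\<Sum>v\<in>V. deg v)"
      using sum_mono[of V "\<lambda>_. 2" deg] by simp
    moreover have "3 dvd card V \<or> \<not> (\<Sum>v\<in>V. deg v) \<le> 2 * card V + 2"
      using small_excess_dvd_card_V True by blast
    ultimately show ?thesis using even by presburger
  next
    case False
    then obtain v where v: "v \<in> V" "deg v \<le> 1" by force
    show ?thesis
    proof (cases "deg v = 0")
      case True
      then have empty: "Collect (R v) = {}" by simp
      \<comment> \<open>The isolated \<open>v\<close> adds nothing to the union in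
        \<open>four\<close>, so all four elements are neighbours of \<open>u\<close>.\<close>
      have "4 \<le> deg u" if "u \<in> V - {v}" for u
        using four[of u v] sym[of u v] that v empty by auto
      then have "4 * card (V - {v}) \<le> (\<Sum>u\<in>V - {v}. deg u)"
        using sum_mono[of "V - {v}" "\<lambda>_. 4" deg] by simp
      also have "\<dots> \<le> (\<Sum>u\<in>V. deg u)"
        using finite_V by (intro sum_mono2) auto
      finally have "4 * (card V - 1) \<le> (\<Sum>u\<in>V. deg u)"
        using v finite_V by simp
      then show ?thesis using assms(1) by presburger
    next
      case False
      then have "deg v = 1" using v(2) by linarith
      then obtain w where w: "Collect (R v) = {w}" by (rule card_1_singletonE)
      then have "R v w" by blast
      then have "w \<in> V" "w \<noteq> v" "R w v" using in_V sym irrefl by blast+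
      \<comment> \<open>Here \<open>v\<close> contributes only \<open>w\<close> to the union, so
        \<open>u\<close> has at least three neighbours.\<close>
      have "3 \<le> deg u" if u: "u \<in> V - {v, w}" for u
      proof -
        have "\<not> R u v" using w u sym by blast
        then have "4 \<le> card (insert w (Collect (R u)))"
          using four[of u v] u v w by simp
        then show ?thesis using card_insert_le_m1[of 4 "Collect (R u)" w]
          by (auto simp: card_insert_if split: if_splits)
      qed
      then have "3 * card (V - {v, w}) \<le> (\<Sum>u\<in>V - {v, w}. deg u)"
        using sum_mono[of "V - {v, w}" "\<lambda>_. 3" deg] by simp
      moreover have "(\<Sum>u\<in>V. deg u) = (\<Sum>u\<in>V - {v, w}. deg u) + (\<Sum>u\<in>{v, w}. deg u)"
        using finite_V v \<open>w \<in> V\<close> by (intro sum.subset_diff) auto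
      moreover have "(\<Sum>u\<in>{v, w}. deg u) = 1 + deg w"
        using \<open>w \<noteq> v\<close> \<open>deg v = 1\<close> by simp
      moreover have "0 < deg w"
        using \<open>R w v\<close> by (subst card_gt_0_iff) auto
      moreover have "card (V - {v, w}) = card V - 2"
        using v \<open>w \<in> V\<close> \<open>w \<noteq> v\<close> by (subst card_Diff_subset) auto
      ultimately have ge: "3 * card V \<le> (\<Sum>u\<in>V. deg u) + 4" by linarith
      obtain m where m: "(\<Sum>u\<in>V. deg u) = 2 * m"
        using even by (rule evenE)
      \<comment> \<open>The bound 3n - 4 is at least 2n + 4 from n = 8 on. For n = 7 it gives 17,
        which parity raises to 18 = 2n + 4; n = 6 is a multiple of 3, so only 2n = 12 is
        needed.\<close>
      consider "card V = 6" | "card V = 7" | "8 \<le> card V"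
        using assms(1) by linarith
      then show ?thesis
      proof cases
        case 2
        then have "9 \<le> m" using ge m by linarith
        then show ?thesis using 2 m by linarith
      qed (use ge in simp_all)
    qed
  qed
  then show "2 * card V \<le> (\<Sum>v\<in>V. deg v)"
    and "\<not> 3 dvd card V \<Longrightarrow> 2 * card V + 4 \<le> (\<Sum>v\<in>V. deg v)" by blast+
qed

end

section \<open>Extremal complements built from disjoint triangles\<close>

text \<open>A new vertex and an old one have disjoint neighbourhoods, so minimum degree 2 on both
  sides gives the required 2 + 2 neighbours. The degree condition is reproduced to allow iteration,
  and the degree sum grows by exactly twice the number of new vertices.\<close>

lemma cobook_add_triangle:
  fixes H :: "nat \<Rightarrow> nat \<Rightarrow> bool"
  assumes "cobook {..<n} H" and deg: "\<forall>v<n. 2 \<le> card (Collect (H v))"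
  defines "H' \<equiv> \<lambda>x y. H x y \<or> x \<noteq> y \<and> x \<in> {n..<n + 3} \<and> y \<in> {n..<n + 3}"
  shows "cobook {..<n + 3} H'"
    and "\<forall>v<n + 3. 2 \<le> card (Collect (H' v))"
    and "card {(x, y). H' x y} = card {(x, y). H x y} + 6"
proof -
  interpret cobook "{..<n}" H by fact
  have lt: "x < n" "y < n" if "H x y" for x y
    using that in_V[of x y] in_V[of y x] sym[of x y] by auto
  have old: "Collect (H' x) = Collect (H x)" if "x < n" for x
    using that by (auto simp: H'_def)
  have new: "Collect (H' x) = {n..<n + 3} - {x}" if "n \<le> x" "x < n + 3" for x
    using that lt by (fastforce simp: H'_def)
  have card_new: "card (Collect (H' x)) = 2" if "n \<le> x" "x < n + 3" for x
    using new[OF that] that by simp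
  show deg': "\<forall>v<n + 3. 2 \<le> card (Collect (H' v))"
    using deg old card_new by (metis le_refl linorder_not_less)
  have mixed: "4 \<le> card (Collect (H' u) \<union> Collect (H' v))" if "u < n" "n \<le> v" "v < n + 3" for u v
  proof -
    have "Collect (H u) \<inter> ({n..<n + 3} - {v}) = {}"
      using lt by fastforce
    then have "card (Collect (H' u) \<union> Collect (H' v)) = card (Collect (H u)) + 2"
      using card_new[of v] that by (subst card_Un_disjoint) (auto simp: old new)
    then show ?thesis using deg that by fastforce
  qed
  show "cobook {..<n + 3} H'"
  proof
    show "H' u v \<Longrightarrow> H' v u" for u v using sym by (auto simp: H'_def)
    show "\<not> H' v v" for v using irrefl by (auto simp: H'_def)
    show "H' u v \<Longrightarrow> u \<in> {..<n + 3}" for u v using lt by (fastforce simp: H'_def)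
    fix u v assume uv: "u \<in> {..<n + 3}" "v \<in> {..<n + 3}" "u \<noteq> v" "\<not> H' u v"
    consider "u < n" "v < n" | "u < n" "n \<le> v" | "n \<le> u" "v < n" | "n \<le> u" "n \<le> v"
      by linarith
    then show "4 \<le> card (Collect (H' u) \<union> Collect (H' v))"
    proof cases
      case 1
      then show ?thesis using four[of u v] uv by (simp add: old) (simp add: H'_def)
    next
      case 2
      then show ?thesis using mixed uv by simp
    next
      case 3
      then show ?thesis using mixed[of v u] uv by (simp add: Un_commute)
    next
      case 4
      then show ?thesis using uv by (auto simp: H'_def)
    qed
  qed simp
  then interpret new: cobook "{..<n + 3}" H' .
  have "(\<Sum>v<n + 3. card (Collect (H' v))) = (\<Sum>v<n. card (Collect (H v))) + 6"
    using old card_new by (simp add: eval_nat_numeral)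
  then show "card {(x, y). H' x y} = card {(x, y). H x y} + 6"
    by (simp only: card_pairs new.card_pairs)
qed

lemma cobook_add_triangles:
  fixes H :: "nat \<Rightarrow> nat \<Rightarrow> bool"
  assumes "cobook {..<n} H" and "\<forall>v<n. 2 \<le> card (Collect (H v))"
  shows "\<exists>H'. cobook {..<n + 3 * k} H' \<and> (\<forall>v<n + 3 * k. 2 \<le> card (Collect (H' v))) \<and>
    card {(x, y). H' x y} = card {(x, y). H x y} + 6 * k"
proof (induction k)
  case 0
  show ?case using assms by (intro exI[of _ H]) simp
next
  case (Suc k)
  then obtain H' where H': "cobook {..<n + 3 * k} H'"
      "\<forall>v<n + 3 * k. 2 \<le> card (Collect (H' v))"
      "card {(x, y). H' x y} = card {(x, y). H x y} + 6 * k"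
    by blast
  obtain H'' where H'': "cobook {..<n + 3 * k + 3} H''"
      "\<forall>v<n + 3 * k + 3. 2 \<le> card (Collect (H'' v))"
      "card {(x, y). H'' x y} = card {(x, y). H' x y} + 6"
    by (rule that[OF cobook_add_triangle[OF H'(1,2)]])
  have eq: "n + 3 * Suc k = n + 3 * k + 3" by simp
  show ?case
    unfolding eq using H'' H'(3) by (intro exI[of _ H'']) simp
qed

lemma cobook_mod_0:
  "\<exists>H. cobook {..<3 * k} H \<and> card {(x, y). H x y} = 6 * k"
proof -
  have "cobook {..<0::nat} (\<lambda>_ _. False)"
    by standard auto
  from cobook_add_triangles[OF this, of k] show ?thesis by auto
qed

text \<open>The complete graph on four vertices satisfies \<open>four\<close> vacuously. Its degree
  sum 12 = 2 * 4 + 4 has the desired excess 4, which added triangles preserve.\<close>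

lemma cobook_mod_1:
  "\<exists>H. cobook {..<3 * k + 4} H \<and> card {(x, y). H x y} = 6 * k + 12"
proof -
  let ?H = "\<lambda>x y :: nat. x < 4 \<and> y < 4 \<and> x \<noteq> y"
  have nbrs: "Collect (?H v) = {..<4} - {v}" if "v < 4" for v
    using that by auto
  have cb: "cobook {..<4} ?H"
    by standard auto
  then interpret cobook "{..<4}" ?H .
  have "card {(x, y). ?H x y} = 12"
    unfolding card_pairs using nbrs by (simp add: eval_nat_numeral)
  moreover have "\<forall>v<4. 2 \<le> card (Collect (?H v))"
    using nbrs by simp
  ultimately show ?thesis
    using cobook_add_triangles[OF cb, of k] by (auto simp: add.commute)
qed

lemma cobook_mod_2:
  "\<exists>H. cobook {..<3 * k + 8} H \<and> card {(x, y). H x y} = 6 * k + 20"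
proof -
  \<comment> \<open>a 4-cycle \<open>0, 1, 2, 3\<close> whose opposite vertices are joined by the paths
    \<open>0, 4, 6, 2\<close> and \<open>1, 5, 7, 3\<close>\<close>
  define L :: "nat list list"
    where "L = [[1,3,4], [0,2,5], [1,3,6], [0,2,7], [0,6], [1,7], [2,4], [3,5]]"
  define H where "H = (\<lambda>x y. x < 8 \<and> y \<in> set (L ! x))"
  have nbrs: "Collect (H v) = set (L ! v)" if "v < 8" for v
    using that by (auto simp: H_def)
  have sym: "\<forall>x\<in>set [0..<8]. \<forall>y\<in>set (L ! x). y < 8 \<and> x \<in> set (L ! y)"
    unfolding L_def by code_simp
  have irrefl: "\<forall>x\<in>set [0..<8]. x \<notin> set (L ! x)"
    unfolding L_def by code_simp
  have four: "\<forall>x\<in>set [0..<8]. \<forall>y\<in>set [0..<8]. x \<noteq> y \<longrightarrow> y \<notin> set (L ! x) \<longrightarrow>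
      4 \<le> card (set (L ! x @ L ! y))"
    unfolding L_def by (simp add: upt_rec card_insert_if)
  have deg: "\<forall>x\<in>set [0..<8]. 2 \<le> card (set (L ! x))"
    unfolding L_def by (simp add: upt_rec card_insert_if)
  have cb: "cobook {..<8} H"
  proof
    show "H u v \<Longrightarrow> H v u" for u v
      using sym[rule_format, of u v] by (simp add: H_def)
    show "\<not> H v v" for v
      using irrefl by (simp add: H_def)
    show "H u v \<Longrightarrow> u \<in> {..<8}" for u v by (auto simp: H_def)
    show "4 \<le> card (Collect (H u) \<union> Collect (H v))"
      if "u \<in> {..<8}" "v \<in> {..<8}" "u \<noteq> v" "\<not> H u v" for u v
      using four[rule_format, of u v] that by (simp add: nbrs) (simp add: H_def)
  qed simp
  then interpret cobook "{..<8}" H .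
  \<comment> \<open>Four vertices have degree 3 and four have degree 2, so the sum is 2 * 8 +
    4.\<close>
  have "(\<Sum>v<8. card (set (L ! v))) = 20"
    unfolding L_def by (simp add: lessThan_nat_numeral lessThan_Suc card_insert_if)
  then have "card {(x, y). H x y} = 20"
    unfolding card_pairs using nbrs by simp
  moreover have "\<forall>v<8. 2 \<le> card (Collect (H v))"
    using nbrs deg by simp
  ultimately show ?thesis
    using cobook_add_triangles[OF cb, of k] by (auto simp: add.commute)
qed

section \<open>Translating book-freeness to the complement\<close>

lemma simple_graph_edgeD:
  assumes "simple_graph G" and "{x, y} \<in> edges G"
  shows "x \<noteq> y" "x \<in> verts G" "y \<in> verts G"
proof -
  have "{x, y} \<subseteq> verts G" "card {x, y} = 2"
    using assms unfolding simple_graph_def by blast+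
  then show "x \<noteq> y" "x \<in> verts G" "y \<in> verts G" by auto
qed

text \<open>The common edge of the book maps to \<open>{u, v}\<close> and the apexes to common
  neighbours; since a copy need not be induced, any \<open>p\<close> common neighbours
  serve.\<close>

lemma contains_book_iff:
  assumes "simple_graph G"
  shows "contains_subgraph G (book p) \<longleftrightarrow>
    (\<exists>u v. {u, v} \<in> edges G \<and> p \<le> card {w. {u, w} \<in> edges G \<and> {v, w} \<in> edges G})"
    (is "_ \<longleftrightarrow> (\<exists>u v. _ \<and> p \<le> card (?W u v))")
proof
  have fin: "finite (?W u v)" for u v
  proof (rule finite_subset)
    show "?W u v \<subseteq> verts G" "finite (verts G)"
      using assms unfolding simple_graph_def by blast+
  qed
  {
    assume "contains_subgraph G (book p)"
    then obtain f where f: "inj_on f {..<p + 2}" "\<forall>e\<in>edges (book p). f ` e \<in> edges G"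
      by (auto simp: contains_subgraph_def book_def)
    have "f ` {0, 1} \<in> edges G"
      using f(2) by (rule bspec) (simp add: book_def)
    moreover have "f ` {2..<p + 2} \<subseteq> ?W (f 0) (f 1)"
    proof
      fix w assume "w \<in> f ` {2..<p + 2}"
      then obtain i where i: "w = f i" "i \<in> {2..<p + 2}" by blast
      then have "{0, i} \<in> edges (book p)" "{1, i} \<in> edges (book p)"
        by (auto simp: book_def)
      then have "f ` {0, i} \<in> edges G" "f ` {1, i} \<in> edges G"
        using f(2) by blast+
      then show "w \<in> ?W (f 0) (f 1)" using i(1) by simp
    qed
    then have "card (f ` {2..<p + 2}) \<le> card (?W (f 0) (f 1))"
      by (rule card_mono[OF fin])
    moreover have "card (f ` {2..<p + 2}) = p"
      by (subst card_image) (auto intro: inj_on_subset[OF f(1)])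
    ultimately show "\<exists>u v. {u, v} \<in> edges G \<and> p \<le> card (?W u v)" by auto
  }
  {
    assume "\<exists>u v. {u, v} \<in> edges G \<and> p \<le> card (?W u v)"
    then obtain u v where uv: "{u, v} \<in> edges G" and le: "p \<le> card (?W u v)" by blast
    obtain W where W: "W \<subseteq> ?W u v" "card W = p" and "finite W"
      using le by (rule obtain_subset_with_card_n)
    note E = simple_graph_edgeD[OF assms]
    obtain g where g: "bij_betw g {2..<p + 2} W"
      using finite_same_card_bij[of "{2..<p + 2}" W] W(2) \<open>finite W\<close> by auto
    then have gW: "g i \<in> W" if "2 \<le> i" "i < p + 2" for i
      using that by (auto simp: bij_betw_def)
    define f where "f i = (if i = 0 then u else if i = 1 then v else g i)" for i
    have uvW: "{u, w} \<in> edges G" "{v, w} \<in> edges G" if "w \<in> W" for w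
      using W that by auto
    have f: "f 0 = u" "f (Suc 0) = v" "\<And>i. 2 \<le> i \<Longrightarrow> f i = g i"
      by (auto simp: f_def)
    have split: "{..<p + 2} = {0, 1} \<union> {2..<p + 2}" by auto
    have img: "f ` {2..<p + 2} = W"
      using g f(3) unfolding bij_betw_def
      by (metis (no_types, lifting) atLeastLessThan_iff image_cong)
    have notin: "u \<notin> W" "v \<notin> W"
      using E(1)[OF uvW(1)] E(1)[OF uvW(2)] by blast+
    have "inj_on f {2..<p + 2}"
      using g f(3) by (simp add: bij_betw_def inj_on_def)
    moreover have "inj_on f {0, 1}" using f E(1)[OF uv] by simp
    moreover have "f ` ({0, 1} - {2..<p + 2}) \<inter> f ` ({2..<p + 2} - {0, 1}) = {}"
      using img notin f by auto
    ultimately have "inj_on f {..<p + 2}"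
      unfolding split inj_on_Un by blast
    moreover have "W \<subseteq> verts G" using E(3)[OF uvW(1)] by blast
    then have "f ` {..<p + 2} \<subseteq> verts G"
      unfolding split image_Un img using E(2,3)[OF uv] f by simp
    moreover have "\<forall>e\<in>edges (book p). f ` e \<in> edges G"
    proof
      fix e assume "e \<in> edges (book p)"
      then consider "e = {0, 1}" | i where "2 \<le> i" "i < p + 2" "e = {0, i} \<or> e = {1, i}"
        by (auto simp: book_def)
      then show "f ` e \<in> edges G"
      proof cases
        case 1
        then show ?thesis using uv f by simp
      next
        case 2
        then show ?thesis using uvW[OF gW] f by auto
      qed
    qed
    ultimately show "contains_subgraph G (book p)"
      unfolding contains_subgraph_def by (intro exI[of _ f]) (simp add: book_def)
  }
qed

definition co_adj :: "'a graph \<Rightarrow> 'a \<Rightarrow> 'a \<Rightarrow> bool" where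
  "co_adj G u v \<longleftrightarrow> u \<in> verts G \<and> v \<in> verts G \<and> u \<noteq> v \<and> {u, v} \<notin> edges G"

text \<open>For an edge \<open>{u, v}\<close>, the vertices other than \<open>u\<close> and
  \<open>v\<close> that are not common neighbours are exactly the complement neighbours of
  \<open>u\<close> or \<open>v\<close>. Hence there are (p + 5) - 2 - c common neighbours, where c
  is the size of that union, and this is below \<open>p\<close> iff c is at least 4.\<close>

lemma book_free_iff_cobook:
  assumes G: "simple_graph G" and n: "card (verts G) = p + 5"
  shows "\<not> contains_subgraph G (book p) \<longleftrightarrow> cobook (verts G) (co_adj G)"
proof -
  let ?W = "\<lambda>u v. {w. {u, w} \<in> edges G \<and> {v, w} \<in> edges G}"
  let ?N = "\<lambda>u. Collect (co_adj G u)"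
  have fin: "finite (verts G)" using G by (simp add: simple_graph_def)
  note E = simple_graph_edgeD[OF G]
  have count: "card (?W u v) < p \<longleftrightarrow> 4 \<le> card (?N u \<union> ?N v)" if uv: "{u, v} \<in> edges G" for u v
  proof -
    have "?W u v = verts G - ({u, v} \<union> (?N u \<union> ?N v))"
      using E[OF uv] by (auto simp: co_adj_def dest: E)
    moreover have "{u, v} \<union> (?N u \<union> ?N v) \<subseteq> verts G"
      using E[OF uv] by (auto simp: co_adj_def)
    ultimately have "card (?W u v) = card (verts G) - card ({u, v} \<union> (?N u \<union> ?N v))"
      and le: "card ({u, v} \<union> (?N u \<union> ?N v)) \<le> card (verts G)"
      using fin by (simp_all add: card_Diff_subset[OF finite_subset] card_mono)
    moreover have "card ({u, v} \<union> (?N u \<union> ?N v)) = card {u, v} + card (?N u \<union> ?N v)"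
      using uv by (intro card_Un_disjoint)
        (auto simp: co_adj_def insert_commute intro: finite_subset[OF _ fin])
    moreover have "card {u, v} = 2" using E[OF uv] by simp
    ultimately show ?thesis using n by linarith
  qed
  show ?thesis
  proof
    assume "\<not> contains_subgraph G (book p)"
    then have free: "\<And>u v. {u, v} \<in> edges G \<Longrightarrow> card (?W u v) < p"
      unfolding contains_book_iff[OF G] by force
    show "cobook (verts G) (co_adj G)"
    proof
      fix u v assume "u \<in> verts G" "v \<in> verts G" "u \<noteq> v" "\<not> co_adj G u v"
      then have "{u, v} \<in> edges G" by (simp add: co_adj_def)
      then show "4 \<le> card (?N u \<union> ?N v)" using count free by blast
    qed (use fin in \<open>auto simp: co_adj_def insert_commute\<close>)
  next
    assume "cobook (verts G) (co_adj G)"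
    then interpret cobook "verts G" "co_adj G" .
    show "\<not> contains_subgraph G (book p)"
      unfolding contains_book_iff[OF G]
    proof clarify
      fix u v assume uv: "{u, v} \<in> edges G" "p \<le> card (?W u v)"
      then have "4 \<le> card (?N u \<union> ?N v)"
        using E[OF uv(1)] by (intro four) (auto simp: co_adj_def)
      then show False using count[OF uv(1)] uv(2) by linarith
    qed
  qed
qed

section \<open>Counting edges by ordered pairs\<close>

lemma handshake:
  assumes "simple_graph G"
  shows "card {(x, y). {x, y} \<in> edges G} = 2 * card (edges G)"
proof -
  let ?P = "\<lambda>e. {(x, y). {x, y} = e}"
  have fin: "finite (edges G)"
    using assms by (auto simp: simple_graph_def intro: finite_subset[of _ "Pow (verts G)"])
  have P: "finite (?P e) \<and> card (?P e) = 2" if e: "e \<in> edges G" for e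
  proof -
    obtain a b where "e = {a, b}" "a \<noteq> b"
      using assms e by (auto simp: simple_graph_def card_2_iff)
    then have "?P e = {(a, b), (b, a)}" by (auto simp: doubleton_eq_iff)
    then show ?thesis using \<open>a \<noteq> b\<close> by simp
  qed
  have "{(x, y). {x, y} \<in> edges G} = (\<Union>e\<in>edges G. ?P e)" by auto
  also have "card \<dots> = (\<Sum>e\<in>edges G. card (?P e))"
    using fin P by (intro card_UN_disjoint) auto
  also have "\<dots> = 2 * card (edges G)" using P by simp
  finally show ?thesis .
qed

text \<open>Ordered pairs of vertices are either adjacent in the complement, adjacent in
  \<open>G\<close>, or equal. The additive form avoids subtraction on the naturals.\<close>

lemma card_co_adj:
  assumes G: "simple_graph G"
  shows "card {(x, y). co_adj G x y} + 2 * card (edges G) + card (verts G) = card (verts G) ^ 2"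
proof -
  let ?A = "{(x, y). co_adj G x y}" and ?B = "{(x, y). {x, y} \<in> edges G}" and ?V = "verts G"
  let ?D = "(\<lambda>x. (x, x)) ` ?V"
  have fin: "finite ?V" using G by (simp add: simple_graph_def)
  note E = simple_graph_edgeD[OF G]
  have eq: "?V \<times> ?V = (?A \<union> ?B) \<union> ?D"
    by (auto simp: co_adj_def dest: E)
  then have "finite (?A \<union> ?B \<union> ?D)"
    using finite_cartesian_product[OF fin fin] by (simp only:)
  then have finAB: "finite ?A" "finite ?B" unfolding finite_Un by blast+
  have disj: "(?A \<union> ?B) \<inter> ?D = {}" "?A \<inter> ?B = {}"
    by (auto simp: co_adj_def dest: E)
  have "card (?V \<times> ?V) = card (?A \<union> ?B) + card ?D"
    unfolding eq by (intro card_Un_disjoint finite_UnI finite_imageI finAB fin disj)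
  also have "card (?A \<union> ?B) = card ?A + card ?B"
    by (intro card_Un_disjoint finAB disj)
  also have "card ?D = card ?V" by (intro card_image inj_onI) simp
  finally show ?thesis
    using handshake[OF G] by (simp add: card_cartesian_product power2_eq_square)
qed

text \<open>This turns the relations constructed above into graphs. Equality with \<open>H\<close>
  on all naturals is possible because the locale confines \<open>H\<close> to
  \<open>{..<n}\<close>.\<close>

lemma cobook_realization:
  fixes H :: "nat \<Rightarrow> nat \<Rightarrow> bool"
  assumes "cobook {..<n} H"
  obtains G where "simple_graph G" "verts G = {..<n}" "co_adj G = H"
proof
  interpret cobook "{..<n}" H by fact
  let ?G = "({..<n}, {{x, y} | x y. x < n \<and> y < n \<and> x \<noteq> y \<and> \<not> H x y})"
  show "simple_graph ?G" by (auto simp: simple_graph_def)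
  show "verts ?G = {..<n}" by simp
  show "co_adj ?G = H"
  proof (intro ext)
    fix x y
    show "co_adj ?G x y = H x y"
      using in_V[of x y] in_V[of y x] sym[of x y] sym[of y x] irrefl[of x]
      by (auto simp: co_adj_def doubleton_eq_iff)
  qed
qed

section \<open>The extremal number\<close>

text \<open>\<open>H\<close> attains the least degree sum allowed by \<open>degree_sum_ge\<close>.
  By \<open>card_co_adj\<close>, a least degree sum in the complement means a greatest number of
  edges, so the graph with complement \<open>H\<close> is extremal.\<close>

lemma ex_number_book:
  fixes H :: "nat \<Rightarrow> nat \<Rightarrow> bool"
  assumes "p > 0" and H: "cobook {..<p + 5} H"
    and s: "card {(x, y). H x y} = 2 * (p + 5) + (if 3 dvd p + 5 then 0 else 4)" (is "_ = ?s")
  shows "?s + 2 * ex_number (p + 5) (book p) + (p + 5) = (p + 5) ^ 2"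
proof -
  obtain G where G: "simple_graph G" "verts G = {..<p + 5}" "co_adj G = H"
    using cobook_realization[OF H] by blast
  have eq: "?s + 2 * card (edges G) + (p + 5) = (p + 5) ^ 2"
    using card_co_adj[OF G(1)] G s by simp
  have free: "\<not> contains_subgraph G (book p)"
    using book_free_iff_cobook[OF G(1)] G H by simp
  have bound: "card (edges G') \<le> card (edges G)"
    if G': "simple_graph G'" "card (verts G') = p + 5" "\<not> contains_subgraph G' (book p)"
    for G' :: "nat graph"
  proof -
    interpret cobook "verts G'" "co_adj G'"
      using book_free_iff_cobook[OF G'(1,2)] G'(3) by simp
    have eq': "(\<Sum>v\<in>verts G'. deg v) + 2 * card (edges G') + (p + 5) = (p + 5) ^ 2"
      using card_co_adj[OF G'(1)] G'(2) card_pairs by simp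
    \<comment> \<open>The counting identity itself forces the degree sum to be even, since n^2 + n
      is even.\<close>
    have "even ((p + 5) ^ 2 + (p + 5))" by simp
    then have "even (\<Sum>v\<in>verts G'. deg v)"
      unfolding eq'[symmetric] by simp
    from degree_sum_ge[OF _ this] have "?s \<le> (\<Sum>v\<in>verts G'. deg v)"
      using \<open>p > 0\<close> G'(2) by simp
    then show ?thesis using eq eq' by linarith
  qed
  let ?S = "{card (edges G) | G :: nat graph.
    simple_graph G \<and> card (verts G) = p + 5 \<and> \<not> contains_subgraph G (book p)}"
  have le: "m \<le> card (edges G)" if "m \<in> ?S" for m
    using that bound by blast
  then have "?S \<subseteq> {..card (edges G)}" by blast
  then have "finite ?S" by (rule finite_subset) simp
  moreover have "card (edges G) \<in> ?S"
    using G free by (intro CollectI exI[of _ G]) simp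
  ultimately have "ex_number (p + 5) (book p) = card (edges G)"
    unfolding ex_number_def using le by (intro Max_eqI)
  then show ?thesis using eq by simp
qed

theorem theorem8:
  fixes p :: nat
  assumes "p > 0"
  shows "(p mod 3 = 1 \<longrightarrow>
            real (ex_number (p + 5) (book p)) = (real p + 2) * (real p + 5) / 2) \<and>
         (p mod 3 = 0 \<or> p mod 3 = 2 \<longrightarrow>
            real (ex_number (p + 5) (book p)) = (real p + 1) * (real p + 6) / 2)"
proof (intro conjI impI)
  let ?e = "ex_number (p + 5) (book p)"
  have main: "real (2 * (p + 5) + (if 3 dvd p + 5 then 0 else 4)) + 2 * real ?e + (real p + 5) =
      (real p + 5) ^ 2"
    if "cobook {..<p + 5} H"
      "card {(x, y). H x y} = 2 * (p + 5) + (if 3 dvd p + 5 then 0 else 4)" for H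
    using arg_cong[OF ex_number_book[OF assms that], of real] by simp
  {
    assume "p mod 3 = 1"
    then have "3 dvd p + 5" by presburger
    then obtain k where k: "p + 5 = 3 * k" by (rule dvdE)
    obtain H where "cobook {..<3 * k} H" "card {(x, y). H x y} = 6 * k"
      using cobook_mod_0 by blast
    \<comment> \<open>With n = p + 5 this says 2e = n(n - 3).\<close>
    then have "2 * (real p + 5) + 2 * real ?e + (real p + 5) = (real p + 5) ^ 2"
      using main[of H] k by simp
    then show "real ?e = (real p + 2) * (real p + 5) / 2"
      by (simp add: power2_eq_square field_simps)
  }
  {
    assume p: "p mod 3 = 0 \<or> p mod 3 = 2"
    then have "\<not> 3 dvd p + 5" by presburger
    have "\<exists>H. cobook {..<p + 5} H \<and> card {(x, y). H x y} = 2 * (p + 5) + 4"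
    proof (cases "p mod 3 = 0")
      case True
      \<comment> \<open>A positive multiple of 3 is at least 3, so \<open>p - 3\<close> is not
        truncated.\<close>
      then have "p + 5 = 3 * ((p - 3) div 3) + 8" using assms by presburger
      then obtain k where k: "p + 5 = 3 * k + 8" by blast
      have eq: "2 * (3 * k + 8) + 4 = 6 * k + 20" by simp
      show ?thesis using cobook_mod_2[of k] by (simp only: k eq)
    next
      case False
      then have "p + 5 = 3 * ((p + 1) div 3) + 4" using p by presburger
      then obtain k where k: "p + 5 = 3 * k + 4" by blast
      have eq: "2 * (3 * k + 4) + 4 = 6 * k + 12" by simp
      show ?thesis using cobook_mod_1[of k] by (simp only: k eq)
    qed
    then obtain H where "cobook {..<p + 5} H" "card {(x, y). H x y} = 2 * (p + 5) + 4"
      by blast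
    \<comment> \<open>With n = p + 5 this says 2e = n^2 - 3n - 4 = (n - 4)(n + 1).\<close>
    then have "2 * (real p + 5) + 4 + 2 * real ?e + (real p + 5) = (real p + 5) ^ 2"
      using main[of H] \<open>\<not> 3 dvd p + 5\<close> by simp
    then show "real ?e = (real p + 1) * (real p + 6) / 2"
      by (simp add: power2_eq_square field_simps)
  }
qed

end
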